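(* Let $\Gamma$ be a finite group with a minimal symmetric set of generators $S=\{s_1,\dots,s_\nu,\tau_1^{\pm1},\dots,\tau_\mu^{\pm1}\}$, where the $s_j$ are the generators of order $2$ and the $\tau_j^{\pm1}$ those of higher order. Let $G=\mathrm{Cay}(\Gamma,S)$ be the associated Cayley graph and $$\Delta_\Gamma=\Big\{(x_1,\dots,x_{\nu+\mu})\in[0,1]^{\nu+\mu}\ \Big|\ \sum_{j=1}^\nu x_j+2\sum_{j=1}^\mu x_{\nu+j}=1\Big\}.$$ Let $\rho:\Gamma\to O(k)$ be an irreducible representation, $\pi_r:\mathbb{R}^k\to\mathbb{R}$ the projection to the $r$-th coordinate, and $S^{k-1}\subset\mathbb{R}^k$ the unit sphere. Let $p\in S^{k-1}$, $\lambda\in\mathbb{R}$ and $X=(x_1,\dots,x_{\nu+\mu})\in\Delta_\Gamma$ be such that $$\lambda p=\sum_{j=1}^\nu x_j\rho(s_j)p+\sum_{j=1}^\mu x_{\nu+j}\big(\rho(\tau_j)p+\rho(\tau_j^{-1})p\big).$$ Then the functions $$\phi_r:\Gamma\to\mathbb{R},\qquad \phi_r(\gamma):=\pi_r(\rho(\gamma)p),\qquad 1\le r\le k,$$ are pairwise orthogonal eigenfunctions of $P_X$ for the eigenvalue $\lambda$, and $\|\phi_r\|^2=\frac{|\Gamma|}{k}$.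
   Context: A finite symmetric generating set $S\subset\Gamma$ is minimal if for every $s\in S$ the set $S\setminus\{s,s^{-1}\}$ no longer generates $\Gamma$. The Cayley graph $\mathrm{Cay}(\Gamma,S)$ has vertex set $\Gamma$, with $\gamma,\gamma'$ joined by an edge iff $\gamma'=\gamma s$ for some $s\in S$. For $X\in\Delta_\Gamma$, the operator $P_X$ on the space of real functions on $\Gamma$ is $$P_Xf(\gamma)=\sum_{j=1}^\nu x_jf(\gamma s_j)+\sum_{j=1}^\mu x_{\nu+j}\big(f(\gamma\tau_j)+f(\gamma\tau_j^{-1})\big).$$ The inner product of functions is $\langle f,g\rangle=\sum_{\gamma\in\Gamma}f(\gamma)g(\gamma)$ and $\|f\|^2=\langle f,f\rangle$. Irreducible means irreducible as a real representation on $\mathbb{R}^k$. *)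

theory Defs
  imports
    "HOL-Analysis.Analysis"
    "HOL-Algebra.Generated_Groups"
    "HOL-Algebra.Multiplicative_Group"
begin

definition minimal_symmetric_generators :: "('a, 'b) monoid_scheme \<Rightarrow> 'a set \<Rightarrow> bool" where
  "minimal_symmetric_generators \<Gamma> S \<longleftrightarrow>
     finite S \<and> S \<subseteq> carrier \<Gamma> \<and>
     (\<forall>s\<in>S. inv\<^bsub>\<Gamma>\<^esub> s \<in> S) \<and>
     generate \<Gamma> S = carrier \<Gamma> \<and>
     (\<forall>s\<in>S. generate \<Gamma> (S - {s, inv\<^bsub>\<Gamma>\<^esub> s}) \<noteq> carrier \<Gamma>)"

text \<open>
  The listing \<open>S = {s 1, \<dots>, s \<nu>, \<tau> 1, inv (\<tau> 1), \<dots>, \<tau> \<mu>, inv (\<tau> \<mu>)}\<close>, without repetitions,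
  where the \<open>s j\<close> have order two and the \<open>\<tau> j\<close> have higher order (so that
  \<open>\<tau> j \<noteq> inv (\<tau> j)\<close>). Only the values of \<open>s\<close> on \<open>{1..\<nu>}\<close> and of \<open>\<tau>\<close> on \<open>{1..\<mu>}\<close> matter.
\<close>

definition generator_listing ::
    "('a, 'b) monoid_scheme \<Rightarrow> 'a set \<Rightarrow> nat \<Rightarrow> (nat \<Rightarrow> 'a) \<Rightarrow> nat \<Rightarrow> (nat \<Rightarrow> 'a) \<Rightarrow> bool" where
  "generator_listing \<Gamma> S \<nu> s \<mu> \<tau> \<longleftrightarrow>
     S = s ` {1..\<nu>} \<union> \<tau> ` {1..\<mu>} \<union> (\<lambda>j. inv\<^bsub>\<Gamma>\<^esub> (\<tau> j)) ` {1..\<mu>} \<and>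
     (\<forall>j\<in>{1..\<nu>}. group.ord \<Gamma> (s j) = 2) \<and>
     (\<forall>j\<in>{1..\<mu>}. group.ord \<Gamma> (\<tau> j) > 2) \<and>
     inj_on s {1..\<nu>} \<and> inj_on \<tau> {1..\<mu>} \<and>
     (\<forall>i\<in>{1..\<mu>}. \<forall>j\<in>{1..\<mu>}. \<tau> i \<noteq> inv\<^bsub>\<Gamma>\<^esub> (\<tau> j))"

text \<open>An undirected graph is a pair of a vertex set and a set of unordered edges.\<close>

definition cayley_graph :: "('a, 'b) monoid_scheme \<Rightarrow> 'a set \<Rightarrow> 'a set \<times> 'a set set" where
  "cayley_graph \<Gamma> S =
     (carrier \<Gamma>, {{\<gamma>, \<gamma>'} | \<gamma> \<gamma>'. \<gamma> \<in> carrier \<Gamma> \<and> \<gamma>' \<in> carrier \<Gamma> \<and> (\<exists>s\<in>S. \<gamma>' = \<gamma> \<otimes>\<^bsub>\<Gamma>\<^esub> s)})"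

text \<open>Points of \<open>[0,1]\<^bsup>\<nu>+\<mu>\<^esup>\<close> are extensional functions on \<open>{1..\<nu>+\<mu>}\<close>.\<close>

definition weights :: "nat \<Rightarrow> nat \<Rightarrow> (nat \<Rightarrow> real) set" where
  "weights \<nu> \<mu> =
     {x \<in> {1..\<nu>+\<mu>} \<rightarrow>\<^sub>E {0..1}. (\<Sum>j=1..\<nu>. x j) + 2 * (\<Sum>j=1..\<mu>. x (\<nu> + j)) = 1}"

text \<open>
  Real functions on a group are total functions on the ambient type, of which only the values on
  the carrier matter; the operator below respects agreement on the carrier.
\<close>

definition cayley_operator ::
    "('a, 'b) monoid_scheme \<Rightarrow> nat \<Rightarrow> (nat \<Rightarrow> 'a) \<Rightarrow> nat \<Rightarrow> (nat \<Rightarrow> 'a) \<Rightarrow> (nat \<Rightarrow> real) \<Rightarrow>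
      ('a \<Rightarrow> real) \<Rightarrow> 'a \<Rightarrow> real" where
  "cayley_operator \<Gamma> \<nu> s \<mu> \<tau> x f = (\<lambda>\<gamma>.
     (\<Sum>j=1..\<nu>. x j * f (\<gamma> \<otimes>\<^bsub>\<Gamma>\<^esub> s j)) +
     (\<Sum>j=1..\<mu>. x (\<nu> + j) * (f (\<gamma> \<otimes>\<^bsub>\<Gamma>\<^esub> \<tau> j) + f (\<gamma> \<otimes>\<^bsub>\<Gamma>\<^esub> inv\<^bsub>\<Gamma>\<^esub> (\<tau> j)))))"

definition eigenfunction_on ::
    "'a set \<Rightarrow> (('a \<Rightarrow> real) \<Rightarrow> 'a \<Rightarrow> real) \<Rightarrow> real \<Rightarrow> ('a \<Rightarrow> real) \<Rightarrow> bool" where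
  "eigenfunction_on A T l f \<longleftrightarrow> (\<exists>\<gamma>\<in>A. f \<gamma> \<noteq> 0) \<and> (\<forall>\<gamma>\<in>A. T f \<gamma> = l * f \<gamma>)"

definition fun_inner :: "'a set \<Rightarrow> ('a \<Rightarrow> real) \<Rightarrow> ('a \<Rightarrow> real) \<Rightarrow> real" where
  "fun_inner A f g = (\<Sum>\<gamma>\<in>A. f \<gamma> * g \<gamma>)"

definition fun_norm :: "'a set \<Rightarrow> ('a \<Rightarrow> real) \<Rightarrow> real" where
  "fun_norm A f = sqrt (fun_inner A f f)"

text \<open>The group \<open>O(k)\<close>, where \<open>k = CARD('k)\<close>.\<close>

definition orthogonal_matrix_group :: "(real ^ 'k ^ 'k) monoid" where
  "orthogonal_matrix_group =
     \<lparr>carrier = {A. orthogonal_matrix A}, monoid.mult = (**), one = mat 1\<rparr>"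

lemma group_orthogonal_matrix_group: "group (orthogonal_matrix_group :: (real ^ 'k ^ 'k) monoid)"
proof (rule groupI)
  fix A :: "real ^ 'k ^ 'k"
  assume "A \<in> carrier orthogonal_matrix_group"
  then have "orthogonal_matrix (Finite_Cartesian_Product.transpose A)"
      "Finite_Cartesian_Product.transpose A ** A = mat 1"
    by (auto simp: orthogonal_matrix_group_def orthogonal_matrix_def)
  then show "\<exists>B\<in>carrier orthogonal_matrix_group.
      B \<otimes>\<^bsub>orthogonal_matrix_group\<^esub> A = \<one>\<^bsub>orthogonal_matrix_group\<^esub>"
    unfolding orthogonal_matrix_group_def by (simp, blast)
qed (auto simp: orthogonal_matrix_group_def orthogonal_matrix_mul orthogonal_matrix_id
      matrix_mul_assoc)

text \<open>
  Irreducibility over the reals. The underlying space \<open>real ^ 'k\<close> is never zero.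
\<close>

definition irreducible_rep :: "('a, 'b) monoid_scheme \<Rightarrow> ('a \<Rightarrow> real ^ 'k ^ 'k) \<Rightarrow> bool" where
  "irreducible_rep \<Gamma> \<rho> \<longleftrightarrow>
     (\<forall>V. subspace V \<and> (\<forall>\<gamma>\<in>carrier \<Gamma>. \<forall>v\<in>V. \<rho> \<gamma> *v v \<in> V) \<longrightarrow> V = {0} \<or> V = UNIV)"

definition coordinate_function ::
    "('a \<Rightarrow> real ^ 'k ^ 'k) \<Rightarrow> real ^ 'k \<Rightarrow> 'k \<Rightarrow> 'a \<Rightarrow> real" where
  "coordinate_function \<rho> p r = (\<lambda>\<gamma>. (\<rho> \<gamma> *v p) $ r)"

end

theory Submission
  imports Defs
begin

text \<open>
  The energy \<open>q v = \<Sum>\<gamma>. (v \<bullet> \<rho> \<gamma> p)\<^sup>2\<close> of a vector against the orbit of \<open>p\<close> is an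
  invariant quadratic form. If \<open>c\<close> is its maximum on the unit sphere, then \<open>c \<parallel>v\<parallel>\<^sup>2 - q v\<close> is a
  nonnegative invariant quadratic form, so by the parallelogram law its zeros form an invariant
  subspace, which is nonzero because the maximum is attained. By irreducibility \<open>q v = c \<parallel>v\<parallel>\<^sup>2\<close> for
  all \<open>v\<close>. Evaluating \<open>q\<close> at the basis vectors and at their sums gives the norms and the
  orthogonality of the coordinate functions, and \<open>c\<close> is found by summing over a basis.
\<close>

text \<open>If \<open>v\<close> and \<open>w\<close> are zeros, the parallelogram law makes the
  nonnegative numbers \<open>Q (v + w)\<close> and \<open>Q (v - w)\<close> sum to zero, so both
  vanish.\<close>

lemma quadratic_form_nonneg_imp_subspace:
  fixes Q :: "'v::real_vector \<Rightarrow> real"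
  assumes nonneg: "\<And>v. 0 \<le> Q v"
    and scale: "\<And>a v. Q (a *\<^sub>R v) = a\<^sup>2 * Q v"
    and parallelogram: "\<And>v w. Q (v + w) + Q (v - w) = 2 * Q v + 2 * Q w"
  shows "subspace {v. Q v = 0}"
proof (rule subspaceI)
  show "0 \<in> {v. Q v = 0}"
    using scale[of 0 0] by simp
next
  fix v w
  assume "v \<in> {v. Q v = 0}" "w \<in> {v. Q v = 0}"
  then show "v + w \<in> {v. Q v = 0}"
    using parallelogram[of v w] nonneg[of "v + w"] nonneg[of "v - w"] by simp
qed (simp add: scale)

text \<open>The quadratic form of the frame operator of the orbit, counted with
  multiplicity.\<close>

definition orbit_energy ::
    "('a, 'b) monoid_scheme \<Rightarrow> ('a \<Rightarrow> real ^ 'k ^ 'k) \<Rightarrow> real ^ 'k \<Rightarrow> real ^ 'k \<Rightarrow> real" where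
  "orbit_energy \<Gamma> \<rho> p v = (\<Sum>\<gamma>\<in>carrier \<Gamma>. (v \<bullet> (\<rho> \<gamma> *v p))\<^sup>2)"

lemma orbit_energy_scaleR: "orbit_energy \<Gamma> \<rho> p (a *\<^sub>R v) = a\<^sup>2 * orbit_energy \<Gamma> \<rho> p v"
  by (simp add: orbit_energy_def power_mult_distrib sum_distrib_left)

text \<open>Polarisation: for basis vectors the cross term is the inner product of two coordinate
  functions.\<close>

lemma orbit_energy_add:
  "orbit_energy \<Gamma> \<rho> p (v + w) = orbit_energy \<Gamma> \<rho> p v + orbit_energy \<Gamma> \<rho> p w +
     2 * (\<Sum>\<gamma>\<in>carrier \<Gamma>. (v \<bullet> (\<rho> \<gamma> *v p)) * (w \<bullet> (\<rho> \<gamma> *v p)))"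
  by (simp add: orbit_energy_def inner_add_left power2_sum sum.distrib sum_distrib_left mult.assoc)

lemma orbit_energy_parallelogram:
  "orbit_energy \<Gamma> \<rho> p (v + w) + orbit_energy \<Gamma> \<rho> p (v - w) =
     2 * orbit_energy \<Gamma> \<rho> p v + 2 * orbit_energy \<Gamma> \<rho> p w"
  using orbit_energy_add[of \<Gamma> \<rho> p v w] orbit_energy_add[of \<Gamma> \<rho> p v "- w"]
    orbit_energy_scaleR[of \<Gamma> \<rho> p "- 1" w]
  by (simp add: sum_negf)

lemma rep_mult_vector:
  assumes "\<rho> \<in> hom \<Gamma> orthogonal_matrix_group" "g \<in> carrier \<Gamma>" "h \<in> carrier \<Gamma>"
  shows "\<rho> (g \<otimes>\<^bsub>\<Gamma>\<^esub> h) *v v = \<rho> g *v (\<rho> h *v v)"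
  using hom_mult[OF assms]
  by (simp add: orthogonal_matrix_group_def matrix_vector_mul_assoc)

lemma rep_orthogonal_transformation:
  assumes "\<rho> \<in> hom \<Gamma> orthogonal_matrix_group" "g \<in> carrier \<Gamma>"
  shows "orthogonal_transformation ((*v) (\<rho> g))"
  using hom_carrier[OF assms(1)] assms(2)
  by (auto simp: orthogonal_matrix_group_def orthogonal_transformation_matrix)

text \<open>Left translation by \<open>g\<close> permutes the group, so \<gamma> may be replaced by
  \<open>g\<close> times \<gamma>; the orthogonal \<open>\<rho> g\<close> then cancels from both
  arguments of the inner product.\<close>

lemma orbit_energy_invariant:
  assumes "group \<Gamma>" and rho: "\<rho> \<in> hom \<Gamma> orthogonal_matrix_group" and g: "g \<in> carrier \<Gamma>"
  shows "orbit_energy \<Gamma> \<rho> p (\<rho> g *v v) = orbit_energy \<Gamma> \<rho> p v"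
proof -
  interpret group \<Gamma> by fact
  have "orbit_energy \<Gamma> \<rho> p (\<rho> g *v v) =
      (\<Sum>\<gamma>\<in>carrier \<Gamma>. ((\<rho> g *v v) \<bullet> (\<rho> (g \<otimes>\<^bsub>\<Gamma>\<^esub> \<gamma>) *v p))\<^sup>2)"
    unfolding orbit_energy_def
    by (rule sum.reindex_cong[of "\<lambda>\<gamma>. g \<otimes>\<^bsub>\<Gamma>\<^esub> \<gamma>"])
      (use g in \<open>auto simp: inj_on_cmult surj_const_mult\<close>)
  also have "\<dots> = orbit_energy \<Gamma> \<rho> p v"
    unfolding orbit_energy_def
    using rep_orthogonal_transformation[OF rho g]
    by (intro sum.cong) (auto simp: rep_mult_vector[OF rho g] orthogonal_transformation_def)
  finally show ?thesis .
qed

lemma orbit_energy_proportional_norm: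
  fixes \<rho> :: "'a \<Rightarrow> real ^ 'k ^ 'k"
  assumes "group \<Gamma>" and rho: "\<rho> \<in> hom \<Gamma> orthogonal_matrix_group"
    and irr: "irreducible_rep \<Gamma> \<rho>"
  obtains c where "\<And>v. orbit_energy \<Gamma> \<rho> p v = c * (v \<bullet> v)"
proof -
  define q where "q = orbit_energy \<Gamma> \<rho> p"
  have "compact (sphere 0 1 :: (real ^ 'k) set)" "sphere 0 1 \<noteq> ({} :: (real ^ 'k) set)"
    by simp_all
  moreover have "continuous_on (sphere 0 1) q"
    unfolding q_def orbit_energy_def by (intro continuous_intros)
  ultimately obtain v0 where v0: "v0 \<in> sphere 0 1" and max: "\<And>v. v \<in> sphere 0 1 \<Longrightarrow> q v \<le> q v0"
    using continuous_attains_sup by metis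
  define Q where "Q v = q v0 * (v \<bullet> v) - q v" for v
  have Q_scale: "Q (a *\<^sub>R v) = a\<^sup>2 * Q v" for a v
    by (simp add: Q_def q_def orbit_energy_scaleR power2_eq_square algebra_simps)
  have "0 \<le> Q v" for v
  \<comment> \<open>Maximality of \<open>v0\<close> only speaks about unit vectors; homogeneity
    carries it over to \<open>v\<close> through its normalisation \<open>sgn v\<close>.\<close>
  proof (cases "v = 0")
    case False
    then have "sgn v \<in> sphere 0 1"
      by (simp add: norm_sgn)
    then have "0 \<le> Q (sgn v)"
      using max by (simp add: Q_def flip: power2_norm_eq_inner)
    moreover have "Q v = (norm v)\<^sup>2 * Q (sgn v)"
      using False by (simp add: sgn_div_norm flip: Q_scale)
    ultimately show ?thesis by simp
  qed (use Q_scale[of 0 0] in simp)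
  moreover have "Q (v + w) + Q (v - w) = 2 * Q v + 2 * Q w" for v w
    using orbit_energy_parallelogram[of \<Gamma> \<rho> p v w]
    by (simp add: Q_def q_def algebra_simps inner_commute)
  ultimately have "subspace {v. Q v = 0}"
    using Q_scale by (intro quadratic_form_nonneg_imp_subspace)
  moreover have "Q (\<rho> g *v v) = Q v" if "g \<in> carrier \<Gamma>" for g v
    using rep_orthogonal_transformation[OF rho that] orbit_energy_invariant[OF assms(1) rho that]
    by (simp add: Q_def q_def orthogonal_transformation_def)
  \<comment> \<open>The maximiser is a nonzero zero of \<open>Q\<close>, which rules out the trivial
    subspace.\<close>
  moreover have "v0 \<in> {v. Q v = 0}" "v0 \<noteq> 0"
    using v0 by (auto simp: Q_def simp flip: power2_norm_eq_inner)
  ultimately have "{v. Q v = 0} = UNIV"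
    using irr unfolding irreducible_rep_def by fastforce
  then have "Q v = 0" for v
    by blast
  then show ?thesis
    by (intro that[of "q v0"]) (simp add: Q_def q_def)
qed

text \<open>A case of Schur orthogonality in which both coefficients use the same vector
  \<open>p\<close>. The form involved is then symmetric and has real eigenvalues, so irreducibility
  over the reals suffices.\<close>

lemma fun_inner_coordinate_function:
  fixes \<rho> :: "'a \<Rightarrow> real ^ 'k ^ 'k"
  assumes "group \<Gamma>" and rho: "\<rho> \<in> hom \<Gamma> orthogonal_matrix_group"
    and irr: "irreducible_rep \<Gamma> \<rho>" and p: "norm p = 1"
  shows "fun_inner (carrier \<Gamma>) (coordinate_function \<rho> p r) (coordinate_function \<rho> p r') =
    (if r = r' then real (order \<Gamma>) / real CARD('k) else 0)"
proof -
  let ?\<phi> = "coordinate_function \<rho> p"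
  obtain c where c: "\<And>v. orbit_energy \<Gamma> \<rho> p v = c * (v \<bullet> v)"
    using orbit_energy_proportional_norm[OF assms(1-3)] by blast
  have diag: "fun_inner (carrier \<Gamma>) (?\<phi> i) (?\<phi> i) = c" for i
    using c[of "axis i 1"]
    by (simp add: fun_inner_def coordinate_function_def orbit_energy_def inner_axis'
        power2_eq_square)
  \<comment> \<open>The energy of the sum of two distinct basis vectors is \<open>2 * c\<close>,
    already the sum of their two energies, so the cross term vanishes.\<close>
  have "fun_inner (carrier \<Gamma>) (?\<phi> i) (?\<phi> j) = 0" if "i \<noteq> j" for i j
    using orbit_energy_add[of \<Gamma> \<rho> p "axis i 1" "axis j 1"] that
    by (simp add: c inner_add_left inner_add_right inner_axis' fun_inner_def
        coordinate_function_def) (simp add: axis_def)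
  \<comment> \<open>Trace computation: summing over coordinates first, each orbit vector contributes
    its squared norm, which is 1.\<close>
  moreover have "real CARD('k) * c = real (order \<Gamma>)"
  proof -
    have "real CARD('k) * c = (\<Sum>i\<in>UNIV. \<Sum>\<gamma>\<in>carrier \<Gamma>. ?\<phi> i \<gamma> * ?\<phi> i \<gamma>)"
      using diag by (simp add: fun_inner_def)
    also have "\<dots> = (\<Sum>\<gamma>\<in>carrier \<Gamma>. (\<rho> \<gamma> *v p) \<bullet> (\<rho> \<gamma> *v p))"
      by (subst sum.swap) (simp add: coordinate_function_def inner_vec_def)
    also have "\<dots> = (\<Sum>\<gamma>\<in>carrier \<Gamma>. 1)"
      using rep_orthogonal_transformation[OF rho] p
      by (intro sum.cong) (auto simp: orthogonal_transformation_def norm_eq_1)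
    finally show ?thesis by (simp add: order_def)
  qed
  ultimately show ?thesis
    using diag by (auto simp: field_simps)
qed

text \<open>The operator multiplies by generators on the right, so \<open>\<rho> g\<close> factors
  out on the left and the weighted sum acts on \<open>p\<close> alone.\<close>

lemma cayley_operator_coordinate_function:
  assumes rho: "\<rho> \<in> hom \<Gamma> orthogonal_matrix_group" and g: "g \<in> carrier \<Gamma>"
    and s: "\<And>j. j \<in> {1..\<nu>} \<Longrightarrow> s j \<in> carrier \<Gamma>"
    and t: "\<And>j. j \<in> {1..\<mu>} \<Longrightarrow> \<tau> j \<in> carrier \<Gamma>"
    and t': "\<And>j. j \<in> {1..\<mu>} \<Longrightarrow> inv\<^bsub>\<Gamma>\<^esub> (\<tau> j) \<in> carrier \<Gamma>"
  shows "cayley_operator \<Gamma> \<nu> s \<mu> \<tau> x (coordinate_function \<rho> p r) g =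
    (\<rho> g *v ((\<Sum>j=1..\<nu>. x j *\<^sub>R (\<rho> (s j) *v p)) +
      (\<Sum>j=1..\<mu>. x (\<nu> + j) *\<^sub>R (\<rho> (\<tau> j) *v p + \<rho> (inv\<^bsub>\<Gamma>\<^esub> (\<tau> j)) *v p)))) $ r"
  by (simp add: cayley_operator_def coordinate_function_def rep_mult_vector[OF rho g] s t t'
      linear_sum[OF matrix_vector_mul_linear] matrix_vector_right_distrib matrix_vector_mult_scaleR)

theorem proposition1p5:
  fixes \<Gamma> :: "('a, 'b) monoid_scheme"
    and S :: "'a set"
    and \<nu> \<mu> :: nat
    and s \<tau> :: "nat \<Rightarrow> 'a"
    and G :: "'a set \<times> 'a set set"
    and \<rho> :: "'a \<Rightarrow> real ^ 'k ^ 'k"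
    and p :: "real ^ 'k"
    and l :: real
    and X :: "nat \<Rightarrow> real"
  assumes "group \<Gamma>" and "finite (carrier \<Gamma>)"
    and "minimal_symmetric_generators \<Gamma> S"
    and "generator_listing \<Gamma> S \<nu> s \<mu> \<tau>"
    and "G = cayley_graph \<Gamma> S"
    and "\<rho> \<in> hom \<Gamma> orthogonal_matrix_group"
    and "irreducible_rep \<Gamma> \<rho>"
    and "p \<in> sphere 0 1"
    and "X \<in> weights \<nu> \<mu>"
    and "l *\<^sub>R p =
      (\<Sum>j=1..\<nu>. X j *\<^sub>R (\<rho> (s j) *v p)) +
      (\<Sum>j=1..\<mu>. X (\<nu> + j) *\<^sub>R (\<rho> (\<tau> j) *v p + \<rho> (inv\<^bsub>\<Gamma>\<^esub> (\<tau> j)) *v p))"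
  shows
    "(\<forall>r. eigenfunction_on (carrier \<Gamma>) (cayley_operator \<Gamma> \<nu> s \<mu> \<tau> X) l
          (coordinate_function \<rho> p r)) \<and>
     (\<forall>r r'. r \<noteq> r' \<longrightarrow>
        fun_inner (carrier \<Gamma>) (coordinate_function \<rho> p r) (coordinate_function \<rho> p r') = 0) \<and>
     (\<forall>r. (fun_norm (carrier \<Gamma>) (coordinate_function \<rho> p r))\<^sup>2 =
        real (order \<Gamma>) / real CARD('k))"
proof -
  interpret group \<Gamma> by fact
  let ?\<phi> = "coordinate_function \<rho> p"
  have "S \<subseteq> carrier \<Gamma>"
    using assms(3) by (simp add: minimal_symmetric_generators_def)
  then have gens: "s ` {1..\<nu>} \<subseteq> carrier \<Gamma>" "\<tau> ` {1..\<mu>} \<subseteq> carrier \<Gamma>"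
    using assms(4) by (auto simp: generator_listing_def)
  have inner: "fun_inner (carrier \<Gamma>) (?\<phi> r) (?\<phi> r') =
      (if r = r' then real (order \<Gamma>) / real CARD('k) else 0)" for r r'
    using assms by (intro fun_inner_coordinate_function) auto
  have "cayley_operator \<Gamma> \<nu> s \<mu> \<tau> X (?\<phi> r) g = l * ?\<phi> r g" if "g \<in> carrier \<Gamma>" for r g
  proof -
    \<comment> \<open>Unfolding the hypothesis on \<open>p\<close> turns
      \<open>l *\<^sub>R p\<close> into the weighted sum to which \<open>\<rho> g\<close> is
      applied.\<close>
    have "cayley_operator \<Gamma> \<nu> s \<mu> \<tau> X (?\<phi> r) g = (\<rho> g *v (l *\<^sub>R p)) $ r"
      unfolding assms(10)
      by (rule cayley_operator_coordinate_function) (use assms(6) that gens in \<open>auto intro!: inv_closed\<close>)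
    then show ?thesis
      by (simp add: coordinate_function_def matrix_vector_mult_scaleR)
  qed
  \<comment> \<open>An eigenfunction must be nonzero on the group; this follows from the norm
    formula, as a finite group has positive order.\<close>
  moreover have "\<exists>g\<in>carrier \<Gamma>. ?\<phi> r g \<noteq> 0" for r
  proof (rule ccontr)
    assume "\<not> ?thesis"
    then have "fun_inner (carrier \<Gamma>) (?\<phi> r) (?\<phi> r) = 0"
      by (simp add: fun_inner_def)
    then show False
      using inner[of r r] assms(2) order_gt_0_iff_finite by simp
  qed
  ultimately show ?thesis
    by (simp add: eigenfunction_on_def fun_norm_def inner)
qed

end
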